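(* Let $r \geq 0$ and $n \geq 0$ be integers and let $a,b,x$ be indeterminates. Then $$\prod_{i=0}^{n-1}\bigl(x+(a+b)r+ai\bigr)=\sum_{k=0}^n \mathcal{G}_{a,b}(n,k;r)\prod_{i=0}^{k-1}(x-bi).$$
   Context: Write $[m]=\{1,\ldots,m\}$, $[0]=\varnothing$. A Lah distribution of $[m]$ into $\ell$ blocks is a partition of $[m]$ into $\ell$ non-empty, pairwise disjoint blocks in which the elements within each block are linearly ordered (the blocks themselves are not ordered). For integers $n,k,r$ with $0\le k\le n$ and $r\ge 0$, let $\mathcal{L}_r(n,k)$ be the set of Lah distributions of $[n+r]$ into $k+r$ blocks in which the elements of $[r]$ belong to distinct blocks. An element $i$ of a Lah distribution $\lambda$ is a record low if there is no element $j<i$ to the left of $i$ within its block. Let $rec^*(\lambda)$ be the number of record lows of $\lambda$ that are not the smallest element of their block, and let $nrec(\lambda)$ be the number of elements of the underlying set that are not record lows of $\lambda$. The generalized $r$-Lah number is the polynomial in indeterminates $a,b$ $$\mathcal{G}_{a,b}(n,k;r)=\sum_{\lambda\in\mathcal{L}_r(n,k)}a^{nrec(\lambda)}b^{rec^*(\lambda)},$$ with $\mathcal{G}_{a,b}(n,k;r)=0$ unless $0\le k\le n$ and $r\ge 0$. Empty sums are $0$ and empty products are $1$. *)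

theory Defs
  imports Main "HOL-Library.Disjoint_Sets"
begin

text \<open>
  A linearly ordered block is a distinct list, read from left to right; a distribution is a set
  of such lists. Injectivity of \<^const>\<open>set\<close> excludes two different orderings of the same block,
  so that together with \<^const>\<open>partition_on\<close> the blocks are non-empty and pairwise disjoint.
\<close>

definition lah_distributions :: "nat set \<Rightarrow> nat \<Rightarrow> nat list set set" where
  "lah_distributions A l =
     {\<Lambda>. partition_on A (set ` \<Lambda>) \<and> inj_on set \<Lambda> \<and> (\<forall>B\<in>\<Lambda>. distinct B) \<and>
         finite \<Lambda> \<and> card \<Lambda> = l}"

definition r_lah_distributions :: "nat \<Rightarrow> nat \<Rightarrow> nat \<Rightarrow> nat list set set" where
  "r_lah_distributions r n k =
     {\<Lambda> \<in> lah_distributions {1..n + r} (k + r).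
        \<forall>i\<in>{1..r}. \<forall>j\<in>{1..r}. i \<noteq> j \<longrightarrow> \<not> (\<exists>B\<in>\<Lambda>. i \<in> set B \<and> j \<in> set B)}"

definition record_low :: "nat list set \<Rightarrow> nat \<Rightarrow> bool" where
  "record_low \<Lambda> i \<longleftrightarrow> (\<exists>B\<in>\<Lambda>. \<exists>p<length B. B ! p = i \<and> \<not> (\<exists>q<p. B ! q < i))"

definition rec_star :: "nat list set \<Rightarrow> nat" where
  "rec_star \<Lambda> = card {i. record_low \<Lambda> i \<and> \<not> (\<exists>B\<in>\<Lambda>. i \<in> set B \<and> i = Min (set B))}"

definition nrec :: "nat list set \<Rightarrow> nat" where
  "nrec \<Lambda> = card {i \<in> (\<Union>B\<in>\<Lambda>. set B). \<not> record_low \<Lambda> i}"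

text \<open>
  The polynomial in the indeterminates \<open>a\<close>, \<open>b\<close> is given by its value at arbitrary elements of an
  arbitrary commutative ring; taking the ring to be a polynomial ring over the integers and
  \<open>a\<close>, \<open>b\<close> to be its variables yields the polynomial itself.
\<close>

definition gen_r_lah :: "'a::comm_ring_1 \<Rightarrow> 'a \<Rightarrow> nat \<Rightarrow> nat \<Rightarrow> nat \<Rightarrow> 'a" where
  "gen_r_lah a b n k r =
     (if k \<le> n then \<Sum>\<Lambda>\<in>r_lah_distributions r n k. a ^ nrec \<Lambda> * b ^ rec_star \<Lambda> else 0)"

end

theory Submission
  imports Defs
begin

text \<open>
  Deleting the largest element \<open>M\<close> of a distribution \<open>\<Lambda>\<close> leaves the status of all other elements
  unchanged. Conversely \<open>M\<close> can be added as a block of its own (factor \<open>1\<close>), at the front of one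
  of the \<open>k + r\<close> blocks (factor \<open>b\<close>), or behind one of the \<open>n + r\<close> elements (factor \<open>a\<close>).
  Weighting each distribution additionally by \<open>\<Prod>i<k. x - b i\<close>, where \<open>k + r\<close> is its number of
  blocks, the three cases contribute the total factor
  \<open>(x - b k) + b (k + r) + a (n + r) = x + (a + b) r + a n\<close>, which no longer depends on \<open>k\<close>.
\<close>

section \<open>Distributions with a free number of blocks\<close>

definition separated_block :: "nat \<Rightarrow> nat list \<Rightarrow> bool" where
  "separated_block r B \<longleftrightarrow>
     B \<noteq> [] \<and> distinct B \<and> (\<forall>i\<in>set B. \<forall>j\<in>set B. i \<in> {1..r} \<longrightarrow> j \<in> {1..r} \<longrightarrow> i = j)"

text \<open>The number of blocks is left open and the ground set is arbitrary: one sum then runs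
  over all \<open>k\<close> at once, and removing a block or the element \<open>M\<close> stays
  within the same family. Disjointness is required of different lists rather than of different sets,
  so that two orderings of one non-empty block are ruled out without \<open>inj_on\<close>.\<close>

definition separated_distributions :: "nat \<Rightarrow> nat set \<Rightarrow> nat list set set" where
  "separated_distributions r A =
     {\<Lambda>. finite \<Lambda> \<and> (\<Union>B\<in>\<Lambda>. set B) = A \<and> (\<forall>B\<in>\<Lambda>. separated_block r B) \<and>
         (\<forall>B\<in>\<Lambda>. \<forall>C\<in>\<Lambda>. B \<noteq> C \<longrightarrow> set B \<inter> set C = {})}"

text \<open>\<open>M\<close> exceeds \<open>r\<close>, so it cannot violate separation. The case
  \<open>u @ v = []\<close> is different: \<open>[M]\<close> is an admissible block, whereas the
  empty list is not.\<close>

lemma separated_block_insert: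
  assumes "r < M" "M \<notin> set (u @ v)" "u @ v \<noteq> []"
  shows "separated_block r (u @ M # v) \<longleftrightarrow> separated_block r (u @ v)"
  using assms unfolding separated_block_def by auto

lemma separated_distributionsI:
  assumes "finite \<Lambda>" "(\<Union>B\<in>\<Lambda>. set B) = A" "\<And>B. B \<in> \<Lambda> \<Longrightarrow> separated_block r B"
    and "\<And>B C. B \<in> \<Lambda> \<Longrightarrow> C \<in> \<Lambda> \<Longrightarrow> B \<noteq> C \<Longrightarrow> set B \<inter> set C = {}"
  shows "\<Lambda> \<in> separated_distributions r A"
  using assms by (simp add: separated_distributions_def)

lemma separated_distributionsD:
  assumes "\<Lambda> \<in> separated_distributions r A"
  shows "finite \<Lambda>" "(\<Union>B\<in>\<Lambda>. set B) = A" "\<And>B. B \<in> \<Lambda> \<Longrightarrow> separated_block r B"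
    and "\<And>B C. B \<in> \<Lambda> \<Longrightarrow> C \<in> \<Lambda> \<Longrightarrow> B \<noteq> C \<Longrightarrow> set B \<inter> set C = {}"
    and "\<And>B. B \<in> \<Lambda> \<Longrightarrow> set B \<subseteq> A" "\<And>B. B \<in> \<Lambda> \<Longrightarrow> B \<noteq> []" "\<And>B. B \<in> \<Lambda> \<Longrightarrow> distinct B"
  using assms by (auto simp: separated_distributions_def separated_block_def)

lemma not_mem_separated_distributions_block:
  assumes "\<Lambda> \<in> separated_distributions r A" "M \<notin> A" "B \<in> \<Lambda>"
  shows "M \<notin> set B"
  using separated_distributionsD(5)[OF assms(1,3)] assms(2) by blast

text \<open>Splits off a single block. Exchanging one block for another then only requires comparing
  the two ground sets that remain for the other blocks.\<close>

lemma insert_mem_separated_distributions: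
  assumes "C \<notin> \<Lambda>"
  shows "insert C \<Lambda> \<in> separated_distributions r A \<longleftrightarrow>
         separated_block r C \<and> set C \<subseteq> A \<and> \<Lambda> \<in> separated_distributions r (A - set C)"
    (is "?L \<longleftrightarrow> ?R")
proof
  assume L: ?L
  note D = separated_distributionsD[OF L]
  have dis: "set B \<inter> set C = {}" if "B \<in> \<Lambda>" for B
    using D(4)[of B C] that assms by blast
  have "\<Lambda> \<in> separated_distributions r (A - set C)"
  proof (rule separated_distributionsI)
    show "(\<Union>B\<in>\<Lambda>. set B) = A - set C" using D(2) dis by auto
  qed (use D in auto)
  with D(3,5)[of C] show ?R by simp
next
  assume R: ?R
  note D = separated_distributionsD[OF R[THEN conjunct2, THEN conjunct2]]
  have dis: "set B \<inter> set C = {}" if "B \<in> \<Lambda>" for B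
    using D(5)[OF that] by blast
  show ?L
  proof (rule separated_distributionsI)
    show "(\<Union>B\<in>insert C \<Lambda>. set B) = A" using D(2) R by auto
    fix B B' assume "B \<in> insert C \<Lambda>" "B' \<in> insert C \<Lambda>" "B \<noteq> B'"
    then show "set B \<inter> set B' = {}" using D(4)[of B B'] dis[of B] dis[of B'] by blast
  qed (use D R in auto)
qed

text \<open>The link to the given definition. Different lists in a partition that is injective under
  \<open>set\<close> have different, hence disjoint, sets; conversely, two disjoint lists with the
  same set are both empty.\<close>

lemma r_lah_distributions_eq:
  "r_lah_distributions r n k = {\<Lambda> \<in> separated_distributions r {1..n + r}. card \<Lambda> = k + r}"
proof (intro set_eqI)
  fix \<Lambda>
  have *: "partition_on A (set ` \<Lambda>) \<and> inj_on set \<Lambda> \<longleftrightarrow>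
      (\<Union>B\<in>\<Lambda>. set B) = A \<and> [] \<notin> \<Lambda> \<and> (\<forall>B\<in>\<Lambda>. \<forall>C\<in>\<Lambda>. B \<noteq> C \<longrightarrow> set B \<inter> set C = {})"
    (is "?L \<longleftrightarrow> ?R") for A :: "nat set"
  proof
    assume L: ?L
    then have "set B \<inter> set C = {}" if "B \<in> \<Lambda>" "C \<in> \<Lambda>" "B \<noteq> C" for B C
    proof -
      have "set B \<noteq> set C" using L that by (auto dest: inj_onD)
      with L that show ?thesis unfolding partition_on_def disjoint_def by blast
    qed
    moreover have "[] \<notin> \<Lambda>"
      using L unfolding partition_on_def by (metis imageI set_empty)
    ultimately show ?R using L unfolding partition_on_def by blast
  next
    assume R: ?R
    have "inj_on set \<Lambda>"
    proof (rule inj_onI, rule ccontr)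
      fix B C assume "B \<in> \<Lambda>" "C \<in> \<Lambda>" "set B = set C" "B \<noteq> C"
      have "set B \<inter> set C = {}" using R \<open>B \<in> \<Lambda>\<close> \<open>C \<in> \<Lambda>\<close> \<open>B \<noteq> C\<close> by blast
      with \<open>set B = set C\<close> have "B = []" by (metis Int_absorb set_empty)
      with R \<open>B \<in> \<Lambda>\<close> show False by simp
    qed
    moreover have "disjoint (set ` \<Lambda>)"
      unfolding disjoint_def using R by (metis imageE)
    moreover have "{} \<notin> set ` \<Lambda>" using R by auto
    ultimately show ?L using R unfolding partition_on_def by simp
  qed
  have sep: "(\<forall>i\<in>{1..r}. \<forall>j\<in>{1..r}. i \<noteq> j \<longrightarrow> \<not> (\<exists>B\<in>\<Lambda>. i \<in> set B \<and> j \<in> set B)) \<and>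
        [] \<notin> \<Lambda> \<and> (\<forall>B\<in>\<Lambda>. distinct B) \<longleftrightarrow> (\<forall>B\<in>\<Lambda>. separated_block r B)"
    unfolding separated_block_def by (intro iffI conjI ballI impI notI; blast)
  show "\<Lambda> \<in> r_lah_distributions r n k \<longleftrightarrow>
        \<Lambda> \<in> {\<Lambda> \<in> separated_distributions r {1..n + r}. card \<Lambda> = k + r}"
    unfolding r_lah_distributions_def lah_distributions_def separated_distributions_def
      mem_Collect_eq sep[symmetric] using *[of "{1..n + r}"] by argo
qed

lemma finite_separated_distributions:
  assumes "finite A"
  shows "finite (separated_distributions r A)"
proof (rule finite_subset)
  show "separated_distributions r A \<subseteq> Pow {xs. set xs \<subseteq> A \<and> distinct xs}"
    by (auto simp: separated_distributions_def separated_block_def)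
  show "finite (Pow {xs. set xs \<subseteq> A \<and> distinct xs})"
    using finite_subset_distinct[OF assms] by simp
qed

lemma sum_length_separated_distributions:
  assumes "\<Lambda> \<in> separated_distributions r A"
  shows "(\<Sum>B\<in>\<Lambda>. length B) = card A"
proof -
  have "card (\<Union>B\<in>\<Lambda>. set B) = (\<Sum>B\<in>\<Lambda>. card (set B))"
    using assms by (intro card_UN_disjoint) (auto simp: separated_distributions_def)
  also have "\<dots> = (\<Sum>B\<in>\<Lambda>. length B)"
    using assms by (intro sum.cong)
      (auto simp: separated_distributions_def separated_block_def distinct_card)
  finally show ?thesis using assms by (simp add: separated_distributions_def)
qed

lemma card_separated_distributions_le:
  assumes "\<Lambda> \<in> separated_distributions r A"
  shows "card \<Lambda> \<le> card A"
proof -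
  have "(\<Sum>B\<in>\<Lambda>. 1) \<le> (\<Sum>B\<in>\<Lambda>. length B)"
    using assms by (intro sum_mono)
      (auto simp: separated_distributions_def separated_block_def Suc_le_eq)
  with sum_length_separated_distributions[OF assms] show ?thesis by simp
qed

text \<open>Sending each \<open>i\<close> in \<open>{1..r}\<close> to its block is injective by
  separation. This is what makes the truncated difference \<open>card \<Lambda> - r\<close> a
  genuine one later.\<close>

lemma card_separated_distributions_ge:
  assumes "\<Lambda> \<in> separated_distributions r A" "{1..r} \<subseteq> A"
  shows "r \<le> card \<Lambda>"
proof -
  have "\<forall>i\<in>{1..r}. \<exists>B\<in>\<Lambda>. i \<in> set B"
    using assms unfolding separated_distributions_def by blast
  then obtain f where f: "\<And>i. i \<in> {1..r} \<Longrightarrow> f i \<in> \<Lambda> \<and> i \<in> set (f i)" by metis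
  have "inj_on f {1..r}"
  proof (rule inj_onI)
    fix i j assume ij: "i \<in> {1..r}" "j \<in> {1..r}" "f i = f j"
    then have "separated_block r (f i)" "i \<in> set (f i)" "j \<in> set (f i)"
      using f[of i] f[of j] separated_distributionsD(3)[OF assms(1)] by auto
    with ij show "i = j" unfolding separated_block_def by blast
  qed
  moreover have "f ` {1..r} \<subseteq> \<Lambda>" using f by blast
  moreover have "finite \<Lambda>" using assms by (simp add: separated_distributions_def)
  ultimately have "card {1..r} \<le> card \<Lambda>" by (metis card_inj_on_le)
  then show ?thesis by simp
qed

section \<open>Record lows under insertion of a new maximum\<close>

lemma record_low_iff:
  "record_low \<Lambda> i \<longleftrightarrow> (\<exists>B\<in>\<Lambda>. \<exists>xs ys. B = xs @ i # ys \<and> (\<forall>j\<in>set xs. i \<le> j))"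
proof -
  have "(\<exists>p<length B. B ! p = i \<and> \<not> (\<exists>q<p. B ! q < i)) \<longleftrightarrow>
        (\<exists>xs ys. B = xs @ i # ys \<and> (\<forall>j\<in>set xs. i \<le> j))" (is "?L \<longleftrightarrow> ?R") for B
  proof
    assume ?L
    then obtain p where p: "p < length B" "B ! p = i" "\<not> (\<exists>q<p. B ! q < i)" by blast
    then have "B = take p B @ i # drop (Suc p) B" by (metis id_take_nth_drop)
    moreover have "\<forall>j\<in>set (take p B). i \<le> j"
    proof
      fix j assume "j \<in> set (take p B)"
      then obtain q where "q < p" "j = B ! q" by (auto simp: in_set_conv_nth)
      with p(3) show "i \<le> j" by (meson not_less)
    qed
    ultimately show ?R by blast
  next
    assume ?R
    then obtain xs ys where B: "B = xs @ i # ys" "\<forall>j\<in>set xs. i \<le> j" by blast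
    then have "\<not> (\<exists>q<length xs. B ! q < i)" by (simp add: nth_append not_less)
    with B(1) show ?L by (intro exI[of _ "length xs"]) simp
  qed
  then show ?thesis unfolding record_low_def by (simp only:)
qed

text \<open>Two marked positions in one list coincide, or the second lies to the left or to the
  right of the first. This serves both the analysis of record lows and the injectivity of
  insertion.\<close>

lemma append_Cons_eq_append_Cons_cases:
  assumes "u @ M # v = xs @ i # ys"
  obtains "u = xs" "M = i" "v = ys"
    | w where "u = xs @ i # w" "ys = w @ M # v"
    | w where "xs = u @ M # w" "v = w @ i # ys"
proof -
  from assms consider us where "u = xs @ us" "us @ M # v = i # ys"
    | us where "xs = u @ us" "M # v = us @ i # ys"
    unfolding append_eq_append_conv2 by blast
  then show thesis
  proof cases
    case (1 us)
    then show thesis using that(1,2) by (cases us) auto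
  next
    case (2 us)
    then show thesis using that(1,3) by (cases us) auto
  qed
qed

text \<open>A larger element in front of \<open>i\<close> never stops \<open>i\<close> from being a
  record low, and \<open>M\<close> itself is one only if nothing precedes it.\<close>

lemma record_low_insert_max:
  assumes "\<forall>j\<in>set (u @ v). j < M" "M \<notin> (\<Union>B\<in>\<Lambda>. set B)"
  shows "record_low (insert (u @ M # v) \<Lambda>) i \<longleftrightarrow>
         record_low (insert (u @ v) \<Lambda>) i \<or> (i = M \<and> u = [])"
proof -
  have "(\<exists>xs ys. u @ M # v = xs @ i # ys \<and> (\<forall>j\<in>set xs. i \<le> j)) \<longleftrightarrow>
      (\<exists>xs ys. u @ v = xs @ i # ys \<and> (\<forall>j\<in>set xs. i \<le> j)) \<or> (i = M \<and> u = [])" (is "?L \<longleftrightarrow> ?R")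
  proof
    assume ?L
    then obtain xs ys where *: "u @ M # v = xs @ i # ys" "\<forall>j\<in>set xs. i \<le> j" by blast
    from *(1) consider "u = xs" "M = i" "v = ys"
      | w where "u = xs @ i # w" "ys = w @ M # v"
      | w where "xs = u @ M # w" "v = w @ i # ys"
      by (rule append_Cons_eq_append_Cons_cases)
    then show ?R
    proof cases
      case 1
      \<comment> \<open>Otherwise the head of \<open>u\<close> would be a smaller element to the
        left of \<open>M\<close>.\<close>
      have "u = []"
      proof (rule ccontr)
        assume "u \<noteq> []"
        with 1 * assms(1) show False by (cases u) (auto simp: leD)
      qed
      with 1 show ?thesis by simp
    next
      case 2
      with * show ?thesis by (intro disjI1 exI[of _ xs] exI[of _ "w @ v"]) auto
    next
      case 3
      with * show ?thesis by (intro disjI1 exI[of _ "u @ w"] exI[of _ ys]) auto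
    qed
  next
    assume ?R
    then consider xs ys where "u @ v = xs @ i # ys" "\<forall>j\<in>set xs. i \<le> j" | "i = M" "u = []"
      by blast
    then show ?L
    proof cases
      case 1
      \<comment> \<open>\<open>i\<close> occurs in \<open>u @ v\<close>. The inequality is what
        allows \<open>M\<close> to join the prefix of \<open>i\<close> when \<open>i\<close> lies in
        \<open>v\<close>.\<close>
      then have "i < M" using assms(1) by simp
      from 1(1) consider w where "u = xs @ i # w" "ys = w @ v"
        | w where "xs = u @ w" "v = w @ i # ys"
        by (auto simp: append_eq_append_conv2 append_eq_Cons_conv Cons_eq_append_conv)
      then show ?thesis
      proof cases
        case a: 1
        with 1 show ?thesis by (intro exI[of _ xs] exI[of _ "w @ M # v"]) auto
      next
        case b: 2
        with 1 \<open>i < M\<close> show ?thesis by (intro exI[of _ "u @ M # w"] exI[of _ ys]) auto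
      qed
    next
      case 2
      then show ?thesis by (intro exI[of _ "[]"] exI[of _ v]) simp
    qed
  qed
  then show ?thesis unfolding record_low_iff bex_simps by blast
qed

lemma record_low_insert_singleton:
  "record_low (insert [M] \<Lambda>) i \<longleftrightarrow> record_low \<Lambda> i \<or> i = M"
proof -
  have "(\<exists>xs ys. [M] = xs @ i # ys \<and> (\<forall>j\<in>set xs. i \<le> j)) \<longleftrightarrow> i = M"
    by (auto simp: Cons_eq_append_conv)
  then show ?thesis unfolding record_low_iff bex_simps by blast
qed

lemma record_low_mem: "record_low \<Lambda> i \<Longrightarrow> i \<in> (\<Union>B\<in>\<Lambda>. set B)"
  unfolding record_low_iff by (metis UN_iff in_set_conv_decomp)

lemma nrec_insert_singleton:
  assumes "M \<notin> (\<Union>B\<in>\<Lambda>. set B)"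
  shows "nrec (insert [M] \<Lambda>) = nrec \<Lambda>"
proof -
  have "{i \<in> (\<Union>B\<in>insert [M] \<Lambda>. set B). \<not> record_low (insert [M] \<Lambda>) i} =
        {i \<in> (\<Union>B\<in>\<Lambda>. set B). \<not> record_low \<Lambda> i}"
    using assms by (auto simp: record_low_insert_singleton)
  then show ?thesis by (simp only: nrec_def)
qed

text \<open>The new element becomes a record low, but as the minimum of its own block it is excluded
  from the count.\<close>

lemma rec_star_insert_singleton:
  assumes "M \<notin> (\<Union>B\<in>\<Lambda>. set B)"
  shows "rec_star (insert [M] \<Lambda>) = rec_star \<Lambda>"
proof -
  have "{i. record_low (insert [M] \<Lambda>) i \<and> \<not> (\<exists>B\<in>insert [M] \<Lambda>. i \<in> set B \<and> i = Min (set B))} =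
        {i. record_low \<Lambda> i \<and> \<not> (\<exists>B\<in>\<Lambda>. i \<in> set B \<and> i = Min (set B))}"
    using assms by (auto simp: record_low_insert_singleton dest: record_low_mem)
  then show ?thesis by (simp only: rec_star_def)
qed

lemma card_Un_if:
  assumes "A = B \<union> (if P then {m} else {})" "finite B" "m \<notin> B"
  shows "card A = card B + (if P then 1 else 0)"
  using assms by simp

lemma nrec_insert_max:
  assumes "\<forall>j\<in>set (u @ v). j < M" "M \<notin> (\<Union>B\<in>\<Lambda>. set B)" "finite \<Lambda>"
  shows "nrec (insert (u @ M # v) \<Lambda>) = nrec (insert (u @ v) \<Lambda>) + (if u \<noteq> [] then 1 else 0)"
proof -
  let ?N = "\<lambda>\<Lambda>. {i \<in> (\<Union>B\<in>\<Lambda>. set B). \<not> record_low \<Lambda> i}"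
  have M: "M \<notin> (\<Union>B\<in>insert (u @ v) \<Lambda>. set B)" using assms by auto
  then have "\<not> record_low (insert (u @ v) \<Lambda>) M" using record_low_mem by blast
  then have "?N (insert (u @ M # v) \<Lambda>) = ?N (insert (u @ v) \<Lambda>) \<union> (if u \<noteq> [] then {M} else {})"
    using M record_low_insert_max[OF assms(1,2)] by auto
  moreover have "finite (?N (insert (u @ v) \<Lambda>))" using assms(3) by simp
  moreover have "M \<notin> ?N (insert (u @ v) \<Lambda>)" using M by blast
  ultimately show ?thesis unfolding nrec_def by (rule card_Un_if)
qed

text \<open>Since \<open>u @ v\<close> is non-empty, its minimum lies below \<open>M\<close> and
  stays the minimum of the enlarged block. So only \<open>M\<close> can change the count, and it
  does so exactly when it stands in front.\<close>

lemma rec_star_insert_max: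
  assumes "\<forall>j\<in>set (u @ v). j < M" "M \<notin> (\<Union>B\<in>\<Lambda>. set B)" "finite \<Lambda>" "u @ v \<noteq> []"
  shows "rec_star (insert (u @ M # v) \<Lambda>) =
         rec_star (insert (u @ v) \<Lambda>) + (if u = [] then 1 else 0)"
proof -
  let ?m = "\<lambda>\<Lambda> i. \<exists>B\<in>\<Lambda>. i \<in> set B \<and> i = Min (set B)"
  let ?R = "\<lambda>\<Lambda>. {i. record_low \<Lambda> i \<and> \<not> ?m \<Lambda> i}"
  have M: "M \<notin> (\<Union>B\<in>insert (u @ v) \<Lambda>. set B)" using assms by auto
  have "Min (set (u @ M # v)) = min M (Min (set (u @ v)))"
    using assms(4) by simp
  also have "\<dots> = Min (set (u @ v))"
    using assms(1) assms(4)
    by (metis List.finite_set Min_in less_imp_le min.absorb2 set_empty)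
  finally have Min: "Min (set (u @ M # v)) = Min (set (u @ v))" .
  \<comment> \<open>Needed for \<open>i = M\<close>: the element \<open>M\<close> belongs to the
    enlarged block only, so equal minima alone do not settle this case.\<close>
  have "Min (set (u @ v)) \<noteq> M"
    using assms(1) assms(4)
    by (metis List.finite_set Min_in less_irrefl set_empty)
  then have m: "?m (insert (u @ M # v) \<Lambda>) i \<longleftrightarrow> ?m (insert (u @ v) \<Lambda>) i" for i
    using Min by auto
  have "\<not> ?m (insert (u @ v) \<Lambda>) M" using M by blast
  then have "?R (insert (u @ M # v) \<Lambda>) = ?R (insert (u @ v) \<Lambda>) \<union> (if u = [] then {M} else {})"
    unfolding m record_low_insert_max[OF assms(1,2)] by auto
  moreover have "finite (?R (insert (u @ v) \<Lambda>))"
    by (rule finite_subset[of _ "\<Union>B\<in>insert (u @ v) \<Lambda>. set B"])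
      (use assms(3) record_low_mem in blast, use assms(3) in simp)
  moreover have "M \<notin> ?R (insert (u @ v) \<Lambda>)" using M record_low_mem by blast
  ultimately show ?thesis unfolding rec_star_def by (rule card_Un_if)
qed

section \<open>Building distributions by inserting the largest element\<close>

definition insert_in_block :: "nat \<Rightarrow> nat list set \<times> nat list \<times> nat \<Rightarrow> nat list set" where
  "insert_in_block M = (\<lambda>(\<Lambda>, B, p). insert (take p B @ M # drop p B) (\<Lambda> - {B}))"

text \<open>The position counts the elements that will precede the new one: \<open>0\<close> is the
  front, and each of \<open>1\<close>, ..., \<open>length B\<close> is the place directly behind one
  element.\<close>

definition insertion_points :: "nat list set \<Rightarrow> (nat list \<times> nat) set" where
  "insertion_points \<Lambda> = (SIGMA B:\<Lambda>. {..length B})"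

lemma insert_in_block_mem:
  assumes "\<Lambda> \<in> separated_distributions r A" "M \<notin> A" "r < M" "B \<in> \<Lambda>"
  shows "insert_in_block M (\<Lambda>, B, p) \<in> separated_distributions r (insert M A)"
proof -
  have "insert B (\<Lambda> - {B}) \<in> separated_distributions r A"
    using assms by (simp add: insert_absorb)
  then have *: "separated_block r B" "set B \<subseteq> A" "\<Lambda> - {B} \<in> separated_distributions r (A - set B)"
    by (subst (asm) insert_mem_separated_distributions; simp)+
  \<comment> \<open>Keeping \<open>take p B @ drop p B\<close> in one piece lets
    \<open>append_take_drop_id\<close> restore \<open>B\<close> afterwards.\<close>
  have "set (take p B @ M # drop p B) = insert M (set (take p B @ drop p B))"
    by (simp only: set_append list.set Un_insert_right)
  then have S: "set (take p B @ M # drop p B) = insert M (set B)"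
    by (simp only: append_take_drop_id)
  have MB: "M \<notin> set B" using * assms(2) by blast
  have "separated_block r (take p B @ M # drop p B)"
    using separated_block_insert[of r M "take p B" "drop p B"] assms(3) * MB
    by (simp add: separated_block_def)
  moreover have "insert M A - set (take p B @ M # drop p B) = A - set B"
    using S assms(2) by auto
  moreover have "take p B @ M # drop p B \<notin> \<Lambda> - {B}"
    using not_mem_separated_distributions_block[OF assms(1,2)]
    by (metis DiffD1 in_set_conv_decomp)
  ultimately show ?thesis
    unfolding insert_in_block_def prod.case
    using insert_mem_separated_distributions * S by auto
qed

text \<open>The element \<open>M\<close> betrays the enlarged block and the place of insertion;
  deleting it recovers the original block, and the other blocks were never touched.\<close>

lemma inj_on_insert_in_block:
  assumes "M \<notin> A"
  shows "inj_on (insert_in_block M) (Sigma (separated_distributions r A) insertion_points)"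
proof (rule inj_onI)
  fix X X' assume X: "X \<in> Sigma (separated_distributions r A) insertion_points"
      "X' \<in> Sigma (separated_distributions r A) insertion_points"
    and XX: "insert_in_block M X = insert_in_block M X'"
  obtain \<Lambda> B p \<Lambda>' B' p' where X_eq: "X = (\<Lambda>, B, p)" "X' = (\<Lambda>', B', p')"
    using prod_cases3 by metis
  with X XX have \<Lambda>: "\<Lambda> \<in> separated_distributions r A" "\<Lambda>' \<in> separated_distributions r A"
    and ip: "(B, p) \<in> insertion_points \<Lambda>" "(B', p') \<in> insertion_points \<Lambda>'"
    and eq: "insert_in_block M (\<Lambda>, B, p) = insert_in_block M (\<Lambda>', B', p')"
    by auto
  let ?C = "take p B @ M # drop p B" and ?C' = "take p' B' @ M # drop p' B'"
  have B: "B \<in> \<Lambda>" "p \<le> length B" "B' \<in> \<Lambda>'" "p' \<le> length B'"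
    using ip by (auto simp: insertion_points_def)
  have noM: "M \<notin> set D" if "D \<in> \<Lambda> \<or> D \<in> \<Lambda>'" for D
    using that not_mem_separated_distributions_block[OF \<Lambda>(1) assms]
      not_mem_separated_distributions_block[OF \<Lambda>(2) assms] by blast
  have ins: "insert ?C (\<Lambda> - {B}) = insert ?C' (\<Lambda>' - {B'})"
    using eq by (simp add: insert_in_block_def)
  \<comment> \<open>On either side of \<open>ins\<close> only the enlarged block contains
    \<open>M\<close>, so the two enlarged blocks coincide.\<close>
  have "M \<in> set ?C" by simp
  then have "?C \<notin> \<Lambda>' - {B'}" using noM[of ?C] by blast
  then have CC: "?C = ?C'" using ins by blast
  have nt: "M \<notin> set (take p B)" "M \<notin> set (take p' B')"
    using noM[of B] noM[of B'] B by (auto dest: in_set_takeD)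
  \<comment> \<open>If the two occurrences of \<open>M\<close> were at different places, one of the
    prefixes would contain \<open>M\<close>.\<close>
  from CC have td: "take p B = take p' B' \<and> drop p B = drop p' B'"
    by (rule append_Cons_eq_append_Cons_cases) (use nt in auto)
  then have BB: "B = B'" by (metis append_take_drop_id)
  \<comment> \<open>The bound \<open>p \<le> length B\<close> enters here: beyond it, different
    positions would give the same prefix.\<close>
  have "length (take p B) = p" "length (take p' B') = p'" using B by simp_all
  with td have pp: "p = p'" by simp
  have "M \<in> set ?C'" by simp
  then have nC: "?C' \<notin> \<Lambda> - {B}" "?C' \<notin> \<Lambda>' - {B'}"
    using noM[of ?C'] by blast+
  have "\<Lambda> - {B} = \<Lambda>' - {B'}"
    using ins unfolding CC insert_ident[OF nC] .
  then have "\<Lambda> = \<Lambda>'" using B BB by blast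
  with BB pp show "X = X'" by (simp add: X_eq)
qed

lemma insert_singleton_mem:
  assumes "\<Lambda> \<in> separated_distributions r A" "M \<notin> A"
  shows "insert [M] \<Lambda> \<in> separated_distributions r (insert M A)"
proof -
  have "[M] \<notin> \<Lambda>" using not_mem_separated_distributions_block[OF assms] by force
  from insert_mem_separated_distributions[OF this] assms show ?thesis
    by (simp add: separated_block_def)
qed

lemma inj_on_insert_singleton:
  assumes "M \<notin> A"
  shows "inj_on (insert [M]) (separated_distributions r A)"
proof -
  have "[M] \<notin> \<Lambda>" if "\<Lambda> \<in> separated_distributions r A" for \<Lambda>
    using not_mem_separated_distributions_block[OF that assms] by force
  then show ?thesis by (metis inj_onI insert_ident)
qed

text \<open>Exhaustiveness comes from deleting \<open>M\<close>: its block either vanishes, if it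
  was \<open>[M]\<close>, or shrinks to a non-empty block \<open>u @ v\<close>.\<close>

lemma separated_distributions_insert:
  assumes "M \<notin> A" "r < M"
  shows "separated_distributions r (insert M A) =
         insert [M] ` separated_distributions r A \<union>
         insert_in_block M ` Sigma (separated_distributions r A) insertion_points" (is "?L = ?R")
proof
  show "?R \<subseteq> ?L"
    using insert_singleton_mem insert_in_block_mem assms
    by (force simp: insertion_points_def)
  show "?L \<subseteq> ?R"
  proof
    fix \<Lambda> assume \<Lambda>: "\<Lambda> \<in> ?L"
    then obtain C where C: "C \<in> \<Lambda>" "M \<in> set C"
      using separated_distributionsD(2)[OF \<Lambda>] by blast
    then obtain u v where uv: "C = u @ M # v" by (meson split_list)
    let ?\<Lambda>0 = "\<Lambda> - {C}"
    have "insert C ?\<Lambda>0 \<in> separated_distributions r (insert M A)"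
      using \<Lambda> C by (simp add: insert_absorb)
    then have *: "separated_block r C" "set C \<subseteq> insert M A"
      "?\<Lambda>0 \<in> separated_distributions r (insert M A - set C)"
      by (subst (asm) insert_mem_separated_distributions; simp)+
    have Mn: "M \<notin> set (u @ v)" using *(1) uv by (auto simp: separated_block_def)
    have sub: "set (u @ v) \<subseteq> A" "insert M A - set C = A - set (u @ v)"
      using *(2) uv Mn assms(1) by auto
    show "\<Lambda> \<in> ?R"
    proof (cases "u @ v = []")
      case True
      then have "\<Lambda> = insert [M] ?\<Lambda>0" using C uv by auto
      moreover have "?\<Lambda>0 \<in> separated_distributions r A" using * sub True by simp
      ultimately show ?thesis by blast
    next
      case False
      let ?\<Lambda>' = "insert (u @ v) ?\<Lambda>0"
      \<comment> \<open>The remaining blocks avoid all elements of \<open>u @ v\<close>, which is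
        non-empty, so the shortened block does not merge with one of them.\<close>
      have nin: "u @ v \<notin> ?\<Lambda>0"
      proof
        assume "u @ v \<in> ?\<Lambda>0"
        then have "set (u @ v) \<subseteq> A - set (u @ v)"
          using separated_distributionsD(5)[OF *(3), of "u @ v"] sub(2) by metis
        with False show False by (auto simp: neq_Nil_conv)
      qed
      have "separated_block r (u @ v)"
        using separated_block_insert[OF assms(2) Mn False] * uv by simp
      then have mem: "?\<Lambda>' \<in> separated_distributions r A"
        using insert_mem_separated_distributions[OF nin] sub * by simp
      \<comment> \<open>Position \<open>length u\<close> cuts \<open>u @ v\<close> back into
        \<open>u\<close> and \<open>v\<close>.\<close>
      have "insert_in_block M (?\<Lambda>', u @ v, length u) = insert C ?\<Lambda>0"
        using nin uv by (simp add: insert_in_block_def)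
      then have "\<Lambda> = insert_in_block M (?\<Lambda>', u @ v, length u)" using C by auto
      moreover have "(u @ v, length u) \<in> insertion_points ?\<Lambda>'"
        by (simp add: insertion_points_def)
      ultimately show ?thesis using mem by blast
    qed
  qed
qed

text \<open>The block of \<open>M\<close> has one element in the first family and at least two in
  the second.\<close>

lemma insert_singleton_insert_in_block_disjoint:
  assumes "M \<notin> A" "r < M"
  shows "insert [M] ` separated_distributions r A \<inter>
         insert_in_block M ` Sigma (separated_distributions r A) insertion_points = {}"
proof (rule ccontr)
  assume "\<not> ?thesis"
  then obtain \<Lambda> \<Lambda>' B p where \<Lambda>: "\<Lambda> \<in> separated_distributions r A"
      "\<Lambda>' \<in> separated_distributions r A" "(B, p) \<in> insertion_points \<Lambda>'"
      and eq: "insert [M] \<Lambda> = insert_in_block M (\<Lambda>', B, p)"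
    by fastforce
  have B: "B \<in> \<Lambda>'" using \<Lambda> by (auto simp: insertion_points_def)
  have "M \<notin> set D" if "D \<in> \<Lambda>" for D
    using not_mem_separated_distributions_block[OF \<Lambda>(1) assms(1) that] .
  moreover have "take p B @ M # drop p B \<in> insert [M] \<Lambda>"
    using eq by (simp add: insert_in_block_def)
  ultimately have "take p B @ M # drop p B = [M]" by (metis in_set_conv_decomp insertE)
  then have "take p B @ drop p B = []" by (auto simp: append_eq_Cons_conv)
  then have "B = []" by (simp only: append_take_drop_id)
  with B \<Lambda> show False by (auto simp: separated_distributions_def separated_block_def)
qed

section \<open>Weights and the recurrence in the size of the ground set\<close>

definition lah_weight :: "'a::comm_ring_1 \<Rightarrow> 'a \<Rightarrow> nat list set \<Rightarrow> 'a" where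
  "lah_weight a b \<Lambda> = a ^ nrec \<Lambda> * b ^ rec_star \<Lambda>"

lemma lah_weight_insert_singleton:
  assumes "\<Lambda> \<in> separated_distributions r A" "M \<notin> A"
  shows "lah_weight a b (insert [M] \<Lambda>) = lah_weight a b \<Lambda>"
    and "card (insert [M] \<Lambda>) = Suc (card \<Lambda>)"
proof -
  have M: "M \<notin> (\<Union>B\<in>\<Lambda>. set B)" and "finite \<Lambda>"
    using assms by (auto simp: separated_distributions_def)
  then show "lah_weight a b (insert [M] \<Lambda>) = lah_weight a b \<Lambda>"
    unfolding lah_weight_def nrec_insert_singleton[OF M] rec_star_insert_singleton[OF M] by simp
  have "[M] \<notin> \<Lambda>" using M by force
  then show "card (insert [M] \<Lambda>) = Suc (card \<Lambda>)" using \<open>finite \<Lambda>\<close> by simp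
qed

lemma lah_weight_insert_in_block:
  assumes "\<Lambda> \<in> separated_distributions r A" "\<forall>j\<in>A. j < M"
    and "(B, p) \<in> insertion_points \<Lambda>"
  shows "lah_weight a b (insert_in_block M (\<Lambda>, B, p)) =
           lah_weight a b \<Lambda> * (if p = 0 then b else a)"
    and "card (insert_in_block M (\<Lambda>, B, p)) = card \<Lambda>"
proof -
  let ?u = "take p B" and ?v = "drop p B" and ?\<Lambda>0 = "\<Lambda> - {B}"
  have B: "B \<in> \<Lambda>" using assms(3) by (simp add: insertion_points_def)
  have U: "(\<Union>B\<in>\<Lambda>. set B) = A" and fin: "finite \<Lambda>" and "B \<noteq> []"
    using assms(1) B by (auto simp: separated_distributions_def separated_block_def)
  have lt: "\<forall>j\<in>set (?u @ ?v). j < M" unfolding append_take_drop_id using U B assms(2) by blast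
  have M: "M \<notin> (\<Union>B\<in>\<Lambda>. set B)" using U assms(2) by blast
  have M0: "M \<notin> (\<Union>B\<in>?\<Lambda>0. set B)" and fin0: "finite ?\<Lambda>0" using M fin by auto
  have ne: "?u @ ?v \<noteq> []" unfolding append_take_drop_id by (rule \<open>B \<noteq> []\<close>)
  have \<Lambda>: "insert (?u @ ?v) ?\<Lambda>0 = \<Lambda>" using B by auto
  \<comment> \<open>For an empty \<open>B\<close> every position would count as the front.\<close>
  have p: "?u = [] \<longleftrightarrow> p = 0" using \<open>B \<noteq> []\<close> by simp
  note n = nrec_insert_max[OF lt M0 fin0, unfolded \<Lambda> p]
    and s = rec_star_insert_max[OF lt M0 fin0 ne, unfolded \<Lambda> p]
  show "lah_weight a b (insert_in_block M (\<Lambda>, B, p)) =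
          lah_weight a b \<Lambda> * (if p = 0 then b else a)"
    unfolding lah_weight_def insert_in_block_def prod.case n s by (simp add: mult_ac)
  have "?u @ M # ?v \<notin> ?\<Lambda>0" using M0 by force
  then have "card (insert (?u @ M # ?v) ?\<Lambda>0) = Suc (card ?\<Lambda>0)" using fin0 by simp
  then show "card (insert_in_block M (\<Lambda>, B, p)) = card \<Lambda>"
    unfolding insert_in_block_def prod.case using card_Suc_Diff1[OF fin B] by simp
qed

text \<open>Each block offers one front place and \<open>length B\<close> places behind an element;
  the block lengths add up to \<open>card A\<close>.\<close>

lemma sum_insertion_points:
  fixes a b :: "'a::comm_ring_1"
  assumes "\<Lambda> \<in> separated_distributions r A"
  shows "(\<Sum>(B, p)\<in>insertion_points \<Lambda>. if p = 0 then b else a) =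
         b * of_nat (card \<Lambda>) + a * of_nat (card A)"
proof -
  have "finite \<Lambda>" using assms by (simp add: separated_distributions_def)
  then have "(\<Sum>(B, p)\<in>insertion_points \<Lambda>. if p = 0 then b else a) =
      (\<Sum>B\<in>\<Lambda>. \<Sum>p\<le>length B. if p = 0 then b else a)"
    unfolding insertion_points_def by (subst sum.Sigma) auto
  \<comment> \<open>\<open>sum.atMost_shift\<close> separates position \<open>0\<close> from the
    others.\<close>
  also have "\<dots> = (\<Sum>B\<in>\<Lambda>. b + a * of_nat (length B))"
    by (simp add: sum.atMost_shift mult.commute)
  also have "\<dots> = b * of_nat (card \<Lambda>) + a * of_nat (\<Sum>B\<in>\<Lambda>. length B)"
    by (simp add: sum.distrib sum_distrib_left mult.commute)
  finally show ?thesis using sum_length_separated_distributions[OF assms] by simp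
qed

text \<open>An arbitrary function \<open>g\<close> of the number of blocks keeps the combinatorial
  recurrence apart from the algebra of the falling product. A new singleton raises the argument of
  \<open>g\<close> by one; insertion into a block leaves it unchanged.\<close>

lemma sum_lah_weight_insert:
  fixes a b :: "'a::comm_ring_1"
  assumes "finite A" "\<forall>j\<in>A. j < M" "r < M"
  shows "(\<Sum>\<Lambda>\<in>separated_distributions r (insert M A). lah_weight a b \<Lambda> * g (card \<Lambda>)) =
         (\<Sum>\<Lambda>\<in>separated_distributions r A. lah_weight a b \<Lambda> *
            (g (Suc (card \<Lambda>)) + (b * of_nat (card \<Lambda>) + a * of_nat (card A)) * g (card \<Lambda>)))"
proof -
  let ?D = "separated_distributions r A"
  let ?f = "\<lambda>\<Lambda>. lah_weight a b \<Lambda> * g (card \<Lambda>)"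
  have M: "M \<notin> A" using assms(2) by blast
  have finD: "finite ?D" using finite_separated_distributions[OF assms(1)] .
  have finI: "finite (insertion_points \<Lambda>)" if "\<Lambda> \<in> ?D" for \<Lambda>
    using that unfolding insertion_points_def separated_distributions_def by simp
  have finS: "finite (Sigma ?D insertion_points)" using finD finI by blast
  have "sum ?f (separated_distributions r (insert M A)) =
      sum ?f (insert [M] ` ?D) + sum ?f (insert_in_block M ` Sigma ?D insertion_points)"
    unfolding separated_distributions_insert[OF M assms(3)]
    using finD finS insert_singleton_insert_in_block_disjoint[OF M assms(3)]
    by (intro sum.union_disjoint) auto
  also have "sum ?f (insert [M] ` ?D) = (\<Sum>\<Lambda>\<in>?D. lah_weight a b \<Lambda> * g (Suc (card \<Lambda>)))"
    by (simp add: sum.reindex[OF inj_on_insert_singleton[OF M]]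
        lah_weight_insert_singleton[OF _ M] cong: sum.cong)
  also have "sum ?f (insert_in_block M ` Sigma ?D insertion_points) =
      (\<Sum>(\<Lambda>, B, p)\<in>Sigma ?D insertion_points.
         lah_weight a b \<Lambda> * g (card \<Lambda>) * (if p = 0 then b else a))"
    unfolding sum.reindex[OF inj_on_insert_in_block[OF M]]
    by (intro sum.cong refl)
      (auto simp: lah_weight_insert_in_block[OF _ assms(2)] mult_ac)
  also have "\<dots> = (\<Sum>\<Lambda>\<in>?D. \<Sum>(B, p)\<in>insertion_points \<Lambda>.
         lah_weight a b \<Lambda> * g (card \<Lambda>) * (if p = 0 then b else a))"
    using finD finI by (subst sum.Sigma) auto
  also have "\<dots> = (\<Sum>\<Lambda>\<in>?D. lah_weight a b \<Lambda> * g (card \<Lambda>) *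
         (b * of_nat (card \<Lambda>) + a * of_nat (card A)))"
    by (intro sum.cong refl)
      (simp add: sum_insertion_points[symmetric] sum_distrib_left case_prod_unfold)
  finally show ?thesis
    by (simp add: sum.distrib[symmetric] algebra_simps)
qed

section \<open>Base case, induction and grouping by the number of blocks\<close>

lemma separated_distributions_initial:
  "separated_distributions r {1..r} = {(\<lambda>i. [i]) ` {1..r}}"
proof
  show "{(\<lambda>i. [i]) ` {1..r}} \<subseteq> separated_distributions r {1..r}"
    by (auto simp: separated_block_def intro!: separated_distributionsI)
  show "separated_distributions r {1..r} \<subseteq> {(\<lambda>i. [i]) ` {1..r}}"
  proof
    fix \<Lambda> assume \<Lambda>: "\<Lambda> \<in> separated_distributions r {1..r}"
    then have U: "(\<Union>B\<in>\<Lambda>. set B) = {1..r}" by (simp add: separated_distributions_def)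
    \<comment> \<open>Inside \<open>{1..r}\<close> separation forces every block to have a single
      element.\<close>
    have single: "B = [i]" if B: "B \<in> \<Lambda>" "i \<in> set B" for B i
    proof -
      have "separated_block r B" "distinct B"
        using separated_distributionsD(3,7)[OF \<Lambda> B(1)] .
      have eq: "j = i" if "j \<in> set B" for j
      proof -
        have "i \<in> {1..r}" "j \<in> {1..r}"
          using separated_distributionsD(5)[OF \<Lambda> B(1)] B(2) that by blast+
        with \<open>separated_block r B\<close> B(2) that show ?thesis
          unfolding separated_block_def by blast
      qed
      have "set B = {i}"
      proof
        show "set B \<subseteq> {i}" using eq by (intro subsetI) simp
        show "{i} \<subseteq> set B" using B(2) by simp
      qed
      then have "length B = 1" using distinct_card[OF \<open>distinct B\<close>] by simp
      then obtain k where "B = [k]" by (auto simp: length_Suc_conv)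
      with B(2) show ?thesis by simp
    qed
    have "\<Lambda> = (\<lambda>i. [i]) ` {1..r}"
    proof (intro equalityI subsetI)
      fix B assume B: "B \<in> \<Lambda>"
      then have hd: "hd B \<in> set B" using separated_distributionsD(6)[OF \<Lambda>] by simp
      then have "B = [hd B]" using single[OF B] by simp
      moreover have "hd B \<in> {1..r}" using separated_distributionsD(5)[OF \<Lambda> B] hd by blast
      ultimately show "B \<in> (\<lambda>i. [i]) ` {1..r}" by (rule image_eqI)
    next
      fix B assume "B \<in> (\<lambda>i. [i]) ` {1..r}"
      then obtain i where i: "B = [i]" "i \<in> {1..r}" by (rule imageE)
      from i(2) obtain C where "C \<in> \<Lambda>" "i \<in> set C" unfolding U[symmetric] by (rule UN_E)
      with single[of C i] i show "B \<in> \<Lambda>" by simp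
    qed
    then show "\<Lambda> \<in> {(\<lambda>i. [i]) ` {1..r}}" by simp
  qed
qed

text \<open>Every element is a record low and the minimum of its block, so both exponents
  vanish.\<close>

lemma lah_weight_singletons: "lah_weight a b ((\<lambda>i. [i]) ` A) = 1"
proof -
  have "(\<exists>xs ys. [k] = xs @ i # ys \<and> (\<forall>j\<in>set xs. i \<le> j)) \<longleftrightarrow> i = k" for k i :: nat
    by (auto simp: Cons_eq_append_conv)
  then have low: "record_low ((\<lambda>i. [i]) ` A) i \<longleftrightarrow> i \<in> A" for i
    unfolding record_low_iff bex_simps by simp
  have "nrec ((\<lambda>i. [i]) ` A) = 0" "rec_star ((\<lambda>i. [i]) ` A) = 0"
    unfolding nrec_def rec_star_def low by simp_all
  then show ?thesis by (simp add: lah_weight_def)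
qed

lemma sum_lah_weight_falling:
  fixes a b x :: "'a::comm_ring_1"
  shows "(\<Sum>\<Lambda>\<in>separated_distributions r {1..n + r}.
            lah_weight a b \<Lambda> * (\<Prod>i<card \<Lambda> - r. x - b * of_nat i)) =
         (\<Prod>i<n. x + (a + b) * of_nat r + a * of_nat i)"
proof (induction n)
  case 0
  \<comment> \<open>Hence \<open>card \<Lambda> - r\<close> is \<open>0\<close> and the falling
    product is empty.\<close>
  have "card ((\<lambda>i. [i]) ` {1..r}) = r" by (simp add: card_image inj_on_def)
  then show ?case
    unfolding add_0 separated_distributions_initial by (simp add: lah_weight_singletons)
next
  case (Suc n)
  let ?D = "separated_distributions r {1..n + r}"
  let ?g = "\<lambda>c. \<Prod>i<c - r. x - b * of_nat i"
  have "{1..Suc n + r} = insert (Suc (n + r)) {1..n + r}" by auto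
  then have "(\<Sum>\<Lambda>\<in>separated_distributions r {1..Suc n + r}. lah_weight a b \<Lambda> * ?g (card \<Lambda>)) =
      (\<Sum>\<Lambda>\<in>?D. lah_weight a b \<Lambda> *
        (?g (Suc (card \<Lambda>)) + (b * of_nat (card \<Lambda>) + a * of_nat (n + r)) * ?g (card \<Lambda>)))"
    using sum_lah_weight_insert[of "{1..n + r}" "Suc (n + r)" r a b ?g] by simp
  also have "\<dots> = (\<Sum>\<Lambda>\<in>?D. lah_weight a b \<Lambda> * ?g (card \<Lambda>) *
        (x + (a + b) * of_nat r + a * of_nat n))"
  proof (intro sum.cong refl)
    fix \<Lambda> assume "\<Lambda> \<in> ?D"
    \<comment> \<open>With this bound \<open>Suc (card \<Lambda>) - r\<close> is the successor of
      \<open>card \<Lambda> - r\<close>, so that \<open>?g (Suc (card \<Lambda>))\<close> is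
      \<open>?g (card \<Lambda>)\<close> times the one further factor
      \<open>x - b * of_nat k\<close>.\<close>
    then have "r \<le> card \<Lambda>" by (rule card_separated_distributions_ge) auto
    then obtain k where k: "card \<Lambda> = r + k" using le_Suc_ex by blast
    show "lah_weight a b \<Lambda> *
        (?g (Suc (card \<Lambda>)) + (b * of_nat (card \<Lambda>) + a * of_nat (n + r)) * ?g (card \<Lambda>)) =
        lah_weight a b \<Lambda> * ?g (card \<Lambda>) * (x + (a + b) * of_nat r + a * of_nat n)"
      unfolding k by (simp add: Suc_diff_le algebra_simps)
  qed
  also have "\<dots> = (\<Prod>i<Suc n. x + (a + b) * of_nat r + a * of_nat i)"
    by (simp only: sum_distrib_right[symmetric] Suc.IH prod.lessThan_Suc)
  finally show ?case .
qed

theorem theorem2p2: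
  fixes a b x :: "'a::comm_ring_1" and n r :: nat
  shows "(\<Prod>i<n. x + (a + b) * of_nat r + a * of_nat i) =
         (\<Sum>k=0..n. gen_r_lah a b n k r * (\<Prod>i<k. x - b * of_nat i))"
proof -
  let ?D = "separated_distributions r {1..n + r}"
  let ?f = "\<lambda>\<Lambda>. lah_weight a b \<Lambda> * (\<Prod>i<card \<Lambda> - r. x - b * of_nat i)"
  have range: "card \<Lambda> - r \<in> {0..n}" "r \<le> card \<Lambda>" if "\<Lambda> \<in> ?D" for \<Lambda>
    using card_separated_distributions_le[OF that] card_separated_distributions_ge[OF that] by auto
  have "(\<Prod>i<n. x + (a + b) * of_nat r + a * of_nat i) = sum ?f ?D"
    by (rule sum_lah_weight_falling[symmetric])
  \<comment> \<open>Grouping loses no term because \<open>card \<Lambda> - r\<close> always lies in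
    \<open>{0..n}\<close>.\<close>
  also have "\<dots> = (\<Sum>k=0..n. sum ?f {\<Lambda> \<in> ?D. card \<Lambda> - r = k})"
    using range(1) by (intro sum.group[symmetric] finite_separated_distributions) auto
  also have "\<dots> = (\<Sum>k=0..n. gen_r_lah a b n k r * (\<Prod>i<k. x - b * of_nat i))"
  proof (intro sum.cong refl)
    fix k assume k: "k \<in> {0..n}"
    \<comment> \<open>For \<open>k = 0\<close> truncated subtraction would also admit fewer than
      \<open>r\<close> blocks; \<open>range(2)\<close> excludes this.\<close>
    have "{\<Lambda> \<in> ?D. card \<Lambda> - r = k} = r_lah_distributions r n k"
      unfolding r_lah_distributions_eq using range(2) by force
    then show "sum ?f {\<Lambda> \<in> ?D. card \<Lambda> - r = k} =
        gen_r_lah a b n k r * (\<Prod>i<k. x - b * of_nat i)"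
      using k by (auto simp: gen_r_lah_def lah_weight_def sum_distrib_right
          r_lah_distributions_eq intro!: sum.cong)
  qed
  finally show ?thesis .
qed

end
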